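(* Let $[M;\mathcal L]$ be a mathematical system with restricted argument lists, $M=[S;A_M;P_M;B_M]$. Let $q\in P_M$ and $j\ge0$ be such that $q$ does not occur $j$-ary in the basis axioms $B_M$. Let $z\in X$ be a variable not occurring in $B_S$, put $C=\;\&\,\forall z\sim z,z\;\neg\forall z\sim z,z$, and for a formula $F$ of $[M;\mathcal L]$ let $\mathcal C(F)$ be obtained by replacing every subformula $q\,\lambda_1,\dots,\lambda_j$ ($\lambda_1,\dots,\lambda_j\in\mathcal L$) by $C$. If $[F_1;\dots;F_l]$ is a proof in $[M;\mathcal L]$, then $[\mathcal C(F_1);\dots;\mathcal C(F_l)]$ is again a proof in $[M;\mathcal L]$ (in which $q$ does not occur $j$-ary).
   Context: Framework. $X$ is a countably infinite set of variables. Formulas are written in Polish (prefix) notation. A recursive system $S=[A_S;P_S;B_S]$ consists of a finite alphabet $A_S$ of constant symbols, a finite list $P_S$ of predicate symbols (the same predicate symbol may be used with several arities) and a finite list $B_S$ of basis R-axioms. Lists (argument terms) are strings built from constant symbols and variables. A prime R-formula is either $p\,\lambda_1,\dots,\lambda_i$ ($p\in P_S$, $i\ge0$; $p$ "occurs $i$-ary") or an equation $\sim\lambda,\mu$. An R-formula is a prime R-formula or $\to F\,G$ with $F$ a prime R-formula and $G$ an R-formula; its last prime formula is its R-conclusion. A mathematical system $M=[S;A_M;P_M;B_M]$ with restricted argument lists $\mathcal L$, written $[M;\mathcal L]$, has $A_M\supseteq A_S$, $P_M\supseteq P_S$, a set $\mathcal L$ of lists containing every variable and closed under substituting lists of $\mathcal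 L$ for variables, and a set $B_M$ of formulas (basis axioms) containing the basis R-axioms $B_S$. Formulas: prime formulas $p\,\lambda_1,\dots,\lambda_i$ ($p\in P_M$) and $\sim\lambda,\mu$ with arguments in $\mathcal L$, and $\neg F$, $J\,F\,G$ ($J\in\{\to,\leftrightarrow,\&,\vee\}$), $\forall x\,F$, $\exists x\,F$. $F\frac{\lambda}{x}=\mathrm{SbF}(F;\lambda;x)$ replaces the free occurrences of $x$ by $\lambda$; $\mathrm{CF}(F;\lambda;x)$ means the substitution is collision-free (no variable of $\lambda$ gets bound). Axioms of $[M;\mathcal L]$: the basis axioms; all instances $\alpha(H_1,\dots,H_m)$ of identically true propositional functions $\alpha$; the axioms of equality (reflexivity $\sim x,x$, and substitutivity of equals in equations and in each predicate symbol $p$ of each arity $n$, e.g. $\to\sim y_1,y_1'\cdots\to\sim y_n,y_n'\;\to p\,y_1,\dots,y_n\;p\,y_1',\dots,y_n'$); the quantifier axioms $\to\forall x F\;F$, $\to\forall x\to F\,G\;\to F\,\forall x\,G$ (if $x\notin\mathrm{free}(F)$), $\leftrightarrow\neg\forall x\neg F\;\exists x F$. Rules of inference: (a) write down an axiom; (b) from $F$ and $\to F\,G$ infer $G$; (c) from $F$ infer $F\frac{\lambda}{x}$ if $\lambda\in\mathcal L$ and $\mathrm{CF}(F;\lambda;x)$; (d) from $F$ infer $\forall x\,F$; (e) induction: let $p\in P_S$, $x_1,\dots,x_i$ distinct variables and $G$ a formula such that $x_1,\dots,x_i$ and the variables of $G$ do not occur in $B_S$; for each $F\in B_S$ let $F'$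 be obtained by replacing every $i$-ary subformula $p\,\lambda_1,\dots,\lambda_i$ by $G\frac{\lambda_1}{x_1}\cdots\frac{\lambda_i}{x_i}$; if $F'$ already occurs in the proof for every $F\in B_S$ whose R-conclusion has $p$ occurring $i$-ary, one may write $\to p\,x_1,\dots,x_i\;G$. A proof is a finite list of formulas each obtained by one of the rules from earlier ones. *)

theory Defs
  imports Main
begin

section \<open>Syntax\<close>

text \<open>The countably infinite set of variables is represented by the type \<^typ>\<open>nat\<close>.\<close>

type_synonym vname = nat

datatype 'c sym = Const 'c | Var vname

text \<open>Argument terms are strings of constant symbols and variables. The empty string is not
  excluded here; the set of restricted argument lists of a system may or may not contain it.\<close>

type_synonym 'c lst = "'c sym list"

definition lists_over :: "'c set \<Rightarrow> 'c lst set" where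
  "lists_over A = {l. \<forall>a. Const a \<in> set l \<longrightarrow> a \<in> A}"

definition lvars :: "'c lst \<Rightarrow> vname set" where
  "lvars l = {x. Var x \<in> set l}"

definition subst_lst :: "'c lst \<Rightarrow> 'c lst \<Rightarrow> vname \<Rightarrow> 'c lst" where
  "subst_lst l m x = concat (map (\<lambda>s. if s = Var x then m else [s]) l)"

datatype conn = CImp | CIff | CAnd | COr

text \<open>Formulas in Polish notation are represented by their syntax trees. A predicate symbol has no
  fixed arity: it is applied to an argument list of any length.\<close>

datatype ('c, 'p) fmla =
    Pred 'p "'c lst list"
  | Eqn "'c lst" "'c lst"
  | Neg "('c, 'p) fmla"
  | Bin conn "('c, 'p) fmla" "('c, 'p) fmla"
  | Forall vname "('c, 'p) fmla"
  | Exists vname "('c, 'p) fmla"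

abbreviation Imp :: "('c, 'p) fmla \<Rightarrow> ('c, 'p) fmla \<Rightarrow> ('c, 'p) fmla" where
  "Imp \<equiv> Bin CImp"

fun fvars :: "('c, 'p) fmla \<Rightarrow> vname set" where
  "fvars (Pred p ls) = (\<Union>l\<in>set ls. lvars l)"
| "fvars (Eqn l m) = lvars l \<union> lvars m"
| "fvars (Neg F) = fvars F"
| "fvars (Bin c F G) = fvars F \<union> fvars G"
| "fvars (Forall x F) = insert x (fvars F)"
| "fvars (Exists x F) = insert x (fvars F)"

fun free :: "('c, 'p) fmla \<Rightarrow> vname set" where
  "free (Pred p ls) = (\<Union>l\<in>set ls. lvars l)"
| "free (Eqn l m) = lvars l \<union> lvars m"
| "free (Neg F) = free F"
| "free (Bin c F G) = free F \<union> free G"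
| "free (Forall x F) = free F - {x}"
| "free (Exists x F) = free F - {x}"

fun SbF :: "('c, 'p) fmla \<Rightarrow> 'c lst \<Rightarrow> vname \<Rightarrow> ('c, 'p) fmla" where
  "SbF (Pred p ls) l x = Pred p (map (\<lambda>k. subst_lst k l x) ls)"
| "SbF (Eqn k m) l x = Eqn (subst_lst k l x) (subst_lst m l x)"
| "SbF (Neg F) l x = Neg (SbF F l x)"
| "SbF (Bin c F G) l x = Bin c (SbF F l x) (SbF G l x)"
| "SbF (Forall y F) l x = (if x = y then Forall y F else Forall y (SbF F l x))"
| "SbF (Exists y F) l x = (if x = y then Exists y F else Exists y (SbF F l x))"

fun CF :: "('c, 'p) fmla \<Rightarrow> 'c lst \<Rightarrow> vname \<Rightarrow> bool" where
  "CF (Pred p ls) l x \<longleftrightarrow> True"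
| "CF (Eqn k m) l x \<longleftrightarrow> True"
| "CF (Neg F) l x \<longleftrightarrow> CF F l x"
| "CF (Bin c F G) l x \<longleftrightarrow> CF F l x \<and> CF G l x"
| "CF (Forall y F) l x \<longleftrightarrow> x \<notin> free (Forall y F) \<or> (y \<notin> lvars l \<and> CF F l x)"
| "CF (Exists y F) l x \<longleftrightarrow> x \<notin> free (Exists y F) \<or> (y \<notin> lvars l \<and> CF F l x)"

fun formula_over :: "'p set \<Rightarrow> 'c lst set \<Rightarrow> ('c, 'p) fmla \<Rightarrow> bool" where
  "formula_over P L (Pred p ls) \<longleftrightarrow> p \<in> P \<and> set ls \<subseteq> L"
| "formula_over P L (Eqn l m) \<longleftrightarrow> l \<in> L \<and> m \<in> L"
| "formula_over P L (Neg F) \<longleftrightarrow> formula_over P L F"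
| "formula_over P L (Bin c F G) \<longleftrightarrow> formula_over P L F \<and> formula_over P L G"
| "formula_over P L (Forall x F) \<longleftrightarrow> formula_over P L F"
| "formula_over P L (Exists x F) \<longleftrightarrow> formula_over P L F"

text \<open>\<open>occurs_ary p i F\<close>: the predicate symbol \<open>p\<close> occurs \<open>i\<close>-ary in \<open>F\<close>.\<close>

fun occurs_ary :: "'p \<Rightarrow> nat \<Rightarrow> ('c, 'p) fmla \<Rightarrow> bool" where
  "occurs_ary p i (Pred r ls) \<longleftrightarrow> r = p \<and> length ls = i"
| "occurs_ary p i (Eqn l m) \<longleftrightarrow> False"
| "occurs_ary p i (Neg F) \<longleftrightarrow> occurs_ary p i F"
| "occurs_ary p i (Bin c F G) \<longleftrightarrow> occurs_ary p i F \<or> occurs_ary p i G"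
| "occurs_ary p i (Forall x F) \<longleftrightarrow> occurs_ary p i F"
| "occurs_ary p i (Exists x F) \<longleftrightarrow> occurs_ary p i F"

text \<open>\<open>replace_ary p i g F\<close> replaces every \<open>i\<close>-ary subformula \<open>Pred p ls\<close> of \<open>F\<close> by \<open>g ls\<close>.\<close>

fun replace_ary ::
  "'p \<Rightarrow> nat \<Rightarrow> ('c lst list \<Rightarrow> ('c, 'p) fmla) \<Rightarrow> ('c, 'p) fmla \<Rightarrow> ('c, 'p) fmla" where
  "replace_ary p i g (Pred r ls) = (if r = p \<and> length ls = i then g ls else Pred r ls)"
| "replace_ary p i g (Eqn l m) = Eqn l m"
| "replace_ary p i g (Neg F) = Neg (replace_ary p i g F)"
| "replace_ary p i g (Bin c F G) = Bin c (replace_ary p i g F) (replace_ary p i g G)"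
| "replace_ary p i g (Forall x F) = Forall x (replace_ary p i g F)"
| "replace_ary p i g (Exists x F) = Exists x (replace_ary p i g F)"


section \<open>Recursive systems\<close>

fun prime :: "('c, 'p) fmla \<Rightarrow> bool" where
  "prime (Pred p ls) = True"
| "prime (Eqn l m) = True"
| "prime _ = False"

inductive R_formula :: "('c, 'p) fmla \<Rightarrow> bool" where
  "prime F \<Longrightarrow> R_formula F"
| "prime F \<Longrightarrow> R_formula G \<Longrightarrow> R_formula (Imp F G)"

fun R_conclusion :: "('c, 'p) fmla \<Rightarrow> ('c, 'p) fmla" where
  "R_conclusion (Bin CImp F G) = R_conclusion G"
| "R_conclusion F = F"

record ('c, 'p) rec_system =
  rs_alph :: "'c set"
  rs_preds :: "'p list"
  rs_axioms :: "('c, 'p) fmla list"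

definition recursive_system :: "('c, 'p) rec_system \<Rightarrow> bool" where
  "recursive_system S \<longleftrightarrow>
     finite (rs_alph S) \<and>
     (\<forall>F\<in>set (rs_axioms S).
        R_formula F \<and> formula_over (set (rs_preds S)) (lists_over (rs_alph S)) F)"

definition rs_vars :: "('c, 'p) rec_system \<Rightarrow> vname set" where
  "rs_vars S = (\<Union>F\<in>set (rs_axioms S). fvars F)"


section \<open>Mathematical systems with restricted argument lists\<close>

record ('c, 'p) math_system =
  ms_rec :: "('c, 'p) rec_system"
  ms_alph :: "'c set"
  ms_preds :: "'p set"
  ms_axioms :: "('c, 'p) fmla set"

abbreviation formula :: "('c, 'p) math_system \<Rightarrow> 'c lst set \<Rightarrow> ('c, 'p) fmla \<Rightarrow> bool" where
  "formula M L \<equiv> formula_over (ms_preds M) L"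

definition mathematical_system :: "('c, 'p) math_system \<Rightarrow> 'c lst set \<Rightarrow> bool" where
  "mathematical_system M L \<longleftrightarrow>
     recursive_system (ms_rec M) \<and>
     rs_alph (ms_rec M) \<subseteq> ms_alph M \<and>
     set (rs_preds (ms_rec M)) \<subseteq> ms_preds M \<and>
     L \<subseteq> lists_over (ms_alph M) \<and>
     (\<forall>x. [Var x] \<in> L) \<and>
     (\<forall>l\<in>L. \<forall>m\<in>L. \<forall>x. subst_lst l m x \<in> L) \<and>
     set (rs_axioms (ms_rec M)) \<subseteq> ms_axioms M \<and>
     (\<forall>F\<in>ms_axioms M. formula M L F)"


section \<open>Axioms\<close>

datatype propf = PVar nat | PNeg propf | PBin conn propf propf

fun conn_val :: "conn \<Rightarrow> bool \<Rightarrow> bool \<Rightarrow> bool" where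
  "conn_val CImp a b = (a \<longrightarrow> b)"
| "conn_val CIff a b = (a \<longleftrightarrow> b)"
| "conn_val CAnd a b = (a \<and> b)"
| "conn_val COr a b = (a \<or> b)"

fun prop_val :: "(nat \<Rightarrow> bool) \<Rightarrow> propf \<Rightarrow> bool" where
  "prop_val v (PVar k) = v k"
| "prop_val v (PNeg a) = (\<not> prop_val v a)"
| "prop_val v (PBin c a b) = conn_val c (prop_val v a) (prop_val v b)"

definition identically_true :: "propf \<Rightarrow> bool" where
  "identically_true a \<longleftrightarrow> (\<forall>v. prop_val v a)"

fun prop_inst :: "(nat \<Rightarrow> ('c, 'p) fmla) \<Rightarrow> propf \<Rightarrow> ('c, 'p) fmla" where
  "prop_inst H (PVar k) = H k"
| "prop_inst H (PNeg a) = Neg (prop_inst H a)"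
| "prop_inst H (PBin c a b) = Bin c (prop_inst H a) (prop_inst H b)"

inductive ax :: "('c, 'p) math_system \<Rightarrow> 'c lst set \<Rightarrow> ('c, 'p) fmla \<Rightarrow> bool"
  for M :: "('c, 'p) math_system" and L :: "'c lst set" where
  basis: "F \<in> ms_axioms M \<Longrightarrow> ax M L F"
| taut: "identically_true a \<Longrightarrow> (\<And>k. formula M L (H k)) \<Longrightarrow> ax M L (prop_inst H a)"
| eq_refl: "ax M L (Eqn [Var x] [Var x])"
| eq_eqn: "l \<in> L \<Longrightarrow> m \<in> L \<Longrightarrow>
    ax M L (Imp (Eqn [Var x] [Var y])
             (Imp (Eqn l m) (Eqn (subst_lst l [Var y] x) (subst_lst m [Var y] x))))"
| eq_pred: "p \<in> ms_preds M \<Longrightarrow> length ys = length ys' \<Longrightarrow>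
    ax M L (foldr Imp (map2 (\<lambda>y y'. Eqn [Var y] [Var y']) ys ys')
             (Imp (Pred p (map (\<lambda>y. [Var y]) ys)) (Pred p (map (\<lambda>y. [Var y]) ys'))))"
| all_elim: "formula M L F \<Longrightarrow> ax M L (Imp (Forall x F) F)"
| all_imp: "formula M L F \<Longrightarrow> formula M L G \<Longrightarrow> x \<notin> free F \<Longrightarrow>
    ax M L (Imp (Forall x (Imp F G)) (Imp F (Forall x G)))"
| all_ex: "formula M L F \<Longrightarrow> ax M L (Bin CIff (Neg (Forall x (Neg F))) (Exists x F))"


text \<open>Substitutivity in equations (\<open>eq_eqn\<close>) replaces equals by equals inside arbitrary lists of
  \<open>L\<close>. Since there is no symbol for concatenation of lists, substitutivity for equations between
  single variables alone would not yield this. In \<open>eq_pred\<close> the variables need not be distinct, and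
  the arity may be zero.\<close>


section \<open>Proofs\<close>

text \<open>The successive substitution of \<open>ls\<close> for \<open>xs\<close>, in order from left to right.\<close>

definition SbFs :: "('c, 'p) fmla \<Rightarrow> 'c lst list \<Rightarrow> vname list \<Rightarrow> ('c, 'p) fmla" where
  "SbFs G ls xs = fold (\<lambda>(l, x) F. SbF F l x) (zip ls xs) G"

text \<open>\<open>step M L \<Gamma> F\<close>: the formula \<open>F\<close> may be written down when the set of formulas already
  occurring in the proof is \<open>\<Gamma>\<close>.\<close>

inductive step ::
  "('c, 'p) math_system \<Rightarrow> 'c lst set \<Rightarrow> ('c, 'p) fmla set \<Rightarrow> ('c, 'p) fmla \<Rightarrow> bool"
  for M :: "('c, 'p) math_system" and L :: "'c lst set" and \<Gamma> :: "('c, 'p) fmla set" where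
  axm: "ax M L F \<Longrightarrow> step M L \<Gamma> F"
| mp: "F \<in> \<Gamma> \<Longrightarrow> Imp F G \<in> \<Gamma> \<Longrightarrow> step M L \<Gamma> G"
| subst: "F \<in> \<Gamma> \<Longrightarrow> l \<in> L \<Longrightarrow> CF F l x \<Longrightarrow> step M L \<Gamma> (SbF F l x)"
| gen: "F \<in> \<Gamma> \<Longrightarrow> step M L \<Gamma> (Forall x F)"
| induction: "p \<in> set (rs_preds (ms_rec M)) \<Longrightarrow> distinct xs \<Longrightarrow> formula M L G \<Longrightarrow>
    set xs \<inter> rs_vars (ms_rec M) = {} \<Longrightarrow> fvars G \<inter> rs_vars (ms_rec M) = {} \<Longrightarrow>
    (\<And>F. F \<in> set (rs_axioms (ms_rec M)) \<Longrightarrow> occurs_ary p (length xs) (R_conclusion F) \<Longrightarrow>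
       replace_ary p (length xs) (\<lambda>ls. SbFs G ls xs) F \<in> \<Gamma>) \<Longrightarrow>
    step M L \<Gamma> (Imp (Pred p (map (\<lambda>x. [Var x]) xs)) G)"

definition is_proof :: "('c, 'p) math_system \<Rightarrow> 'c lst set \<Rightarrow> ('c, 'p) fmla list \<Rightarrow> bool" where
  "is_proof M L Fs \<longleftrightarrow> (\<forall>k<length Fs. step M L (set (take k Fs)) (Fs ! k))"


section \<open>Elimination of a predicate symbol\<close>

definition contradiction :: "vname \<Rightarrow> ('c, 'p) fmla" where
  "contradiction z = Bin CAnd (Forall z (Eqn [Var z] [Var z]))
                              (Neg (Forall z (Eqn [Var z] [Var z])))"

definition eliminate :: "'p \<Rightarrow> nat \<Rightarrow> vname \<Rightarrow> ('c, 'p) fmla \<Rightarrow> ('c, 'p) fmla" where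
  "eliminate q j z = replace_ary q j (\<lambda>ls. contradiction z)"

end

(* Elimination commutes with every syntactic operation in the calculus because the contradiction C is
   closed; hence each step of the proof is transformed into a step of the same kind, with two
   exceptions that become instances of tautologies: substitutivity for q itself ends in C -> C, and
   an induction on q itself yields C -> G. *)
theory Submission
  imports Defs
begin

lemma fvars_contradiction [simp]: "fvars (contradiction z) = {z}"
  by (auto simp: contradiction_def lvars_def)

lemma free_contradiction [simp]: "free (contradiction z) = {}"
  by (auto simp: contradiction_def lvars_def)

lemma SbF_contradiction [simp]: "SbF (contradiction z) l x = contradiction z"
  by (auto simp: contradiction_def subst_lst_def)

text \<open>Holds even if \<open>z\<close> occurs in \<open>l\<close>: \<open>x\<close> is free in
  neither quantified subformula, so nothing is substituted below the quantifiers and no capture can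
  arise.\<close>

lemma CF_contradiction [simp]: "CF (contradiction z) l x"
  by (auto simp: contradiction_def lvars_def)

lemma not_occurs_ary_contradiction [simp]: "\<not> occurs_ary p i (contradiction z)"
  by (simp add: contradiction_def)

lemma formula_over_contradiction [simp]: "formula_over P L (contradiction z) \<longleftrightarrow> [Var z] \<in> L"
  by (simp add: contradiction_def)

lemma eliminate_simps [simp]:
  "eliminate q j z (Pred r ls) = (if r = q \<and> length ls = j then contradiction z else Pred r ls)"
  "eliminate q j z (Eqn l m) = Eqn l m"
  "eliminate q j z (Neg F) = Neg (eliminate q j z F)"
  "eliminate q j z (Bin c F G) = Bin c (eliminate q j z F) (eliminate q j z G)"
  "eliminate q j z (Forall x F) = Forall x (eliminate q j z F)"
  "eliminate q j z (Exists x F) = Exists x (eliminate q j z F)"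
  by (simp_all add: eliminate_def)

lemma not_occurs_ary_eliminate: "\<not> occurs_ary q j (eliminate q j z F)"
  by (induction F) auto

lemma eliminate_id: "\<not> occurs_ary q j F \<Longrightarrow> eliminate q j z F = F"
  by (induction F) auto

text \<open>Only an inclusion: the variables of a replaced atom vanish, while the closed
  \<open>contradiction z\<close> adds none. This preserves the side condition of
  \<open>all_imp\<close> and the quantifiers exempted by \<open>CF\<close>.\<close>

lemma free_eliminate: "free (eliminate q j z F) \<subseteq> free F"
  by (induction F) auto

lemma fvars_eliminate: "fvars (eliminate q j z F) \<subseteq> insert z (fvars F)"
  by (induction F) auto

lemma formula_over_eliminate:
  "formula_over P L F \<Longrightarrow> [Var z] \<in> L \<Longrightarrow> formula_over P L (eliminate q j z F)"
  by (induction F) auto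

text \<open>Substitution keeps the predicate symbol and the number of arguments of an atom, so the
  same atoms are replaced before and after it.\<close>

lemma eliminate_SbF: "eliminate q j z (SbF F l x) = SbF (eliminate q j z F) l x"
  by (induction F) auto

lemma CF_eliminate: "CF F l x \<Longrightarrow> CF (eliminate q j z F) l x"
  using free_eliminate by (induction F) fastforce+

lemma eliminate_SbFs: "eliminate q j z (SbFs G ls xs) = SbFs (eliminate q j z G) ls xs"
proof -
  have "eliminate q j z (fold (\<lambda>(l, x) F. SbF F l x) ps G)
      = fold (\<lambda>(l, x) F. SbF F l x) ps (eliminate q j z G)" for ps
    by (induction ps arbitrary: G) (auto simp: eliminate_SbF)
  then show ?thesis
    by (simp add: SbFs_def)
qed

text \<open>Serves the premises of the induction rule, with \<open>F\<close> a basis R-axiom: no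
  atom of \<open>F\<close> itself is affected, so elimination acts only inside the formulas inserted
  by \<open>g\<close>.\<close>

lemma eliminate_replace_ary:
  assumes "\<not> occurs_ary q j F"
  shows "eliminate q j z (replace_ary p i g F) = replace_ary p i (\<lambda>ls. eliminate q j z (g ls)) F"
  using assms by (induction F) auto

lemma eliminate_prop_inst:
  "eliminate q j z (prop_inst H a) = prop_inst (\<lambda>k. eliminate q j z (H k)) a"
  by (induction a) auto

text \<open>Covers what becomes of substitutivity for \<open>q\<close>: since C -> C is a tautology,
  it stays one under any premises.\<close>

lemma ax_foldr_Imp_refl:
  assumes "\<forall>E\<in>set Es. formula M L E" and "formula M L C"
  shows "ax M L (foldr Imp Es (Imp C C))"
proof -
  \<comment> \<open>Variable \<open>k\<close> stands for the premise at position \<open>k\<close>,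
    variable \<open>length Es\<close> for \<open>C\<close>. The default \<open>C\<close> also makes
    \<open>H k\<close> a formula for every \<open>k\<close>, as \<open>taut\<close> demands.\<close>
  define H where "H k = (if k < length Es then Es ! k else C)" for k
  \<comment> \<open>The list \<open>ks\<close> is kept general so that the inductions on it leave
    the index \<open>length Es\<close> fixed.\<close>
  define a where "a ks = foldr (\<lambda>k. PBin CImp (PVar k)) ks
                           (PBin CImp (PVar (length Es)) (PVar (length Es)))" for ks
  have "prop_val v (a ks)" for v ks
    by (induction ks) (auto simp: a_def)
  then have "identically_true (a [0..<length Es])"
    by (simp add: identically_true_def)
  moreover have "formula M L (H k)" for k
    using assms by (auto simp: H_def)
  ultimately have "ax M L (prop_inst H (a [0..<length Es]))"
    by (rule ax.taut)
  moreover have "prop_inst H (a ks) = foldr Imp (map H ks) (Imp C C)" for ks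
    by (induction ks) (auto simp: a_def H_def)
  moreover have "map H [0..<length Es] = Es"
    by (rule nth_equalityI) (auto simp: H_def)
  ultimately show ?thesis
    by simp
qed

text \<open>Ex falso, as an instance of (P and not P) -> Q with P the quantified equation inside
  \<open>contradiction z\<close>.\<close>

lemma ax_contradiction_Imp:
  assumes "[Var z] \<in> L" and "formula M L G"
  shows "ax M L (Imp (contradiction z) G)"
proof -
  define A where "A = (Forall z (Eqn [Var z] [Var z]) :: ('a, 'b) fmla)"
  define a where "a = PBin CImp (PBin CAnd (PVar 0) (PNeg (PVar 0))) (PVar 1)"
  define H where "H k = (if k = 0 then A else G)" for k :: nat
  have "ax M L (prop_inst H a)"
    using assms by (intro ax.taut) (auto simp: identically_true_def a_def H_def A_def)
  then show ?thesis
    by (simp add: a_def H_def A_def contradiction_def)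
qed

lemma eliminate_foldr_Imp:
  "eliminate q j z (foldr Imp Es F) = foldr Imp (map (eliminate q j z) Es) (eliminate q j z F)"
  by (induction Es) auto

lemma map2_eliminate_Eqn:
  "map (eliminate q j z) (map2 (\<lambda>y y'. Eqn (f y) (g y')) ys ys')
     = map2 (\<lambda>y y'. Eqn (f y) (g y')) ys ys'"
  by auto

lemma ax_eliminate:
  assumes var: "\<And>x. [Var x] \<in> L"
    and nocc: "\<And>F. F \<in> ms_axioms M \<Longrightarrow> \<not> occurs_ary q j F"
    and "ax M L F"
  shows "ax M L (eliminate q j z F)"
  using assms(3)
proof cases
  case basis
  then show ?thesis
    by (simp add: eliminate_id nocc ax.basis)
next
  case (taut a H)
  then show ?thesis
    by (auto simp: eliminate_prop_inst intro!: ax.taut formula_over_eliminate var)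
next
  case eq_refl
  then show ?thesis
    by (auto intro: ax.eq_refl)
next
  case (eq_eqn l m x y)
  then show ?thesis
    by (auto intro: ax.eq_eqn)
next
  case (eq_pred p ys ys')
  show ?thesis
  proof (cases "p = q \<and> length ys = j")
    case True
    \<comment> \<open>Since \<open>ys\<close> and \<open>ys'\<close> have equal length, both atoms
      are \<open>j\<close>-ary and both turn into \<open>contradiction z\<close>; the equations
      remain.\<close>
    then have "eliminate q j z F = foldr Imp (map2 (\<lambda>y y'. Eqn [Var y] [Var y']) ys ys')
                 (Imp (contradiction z) (contradiction z))"
      using eq_pred by (simp only: eliminate_foldr_Imp map2_eliminate_Eqn) simp
    then show ?thesis
      using var by (auto intro!: ax_foldr_Imp_refl)
  next
    case False
    then have "eliminate q j z F = F"
      using eq_pred by (simp only: eliminate_foldr_Imp map2_eliminate_Eqn) auto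
    then show ?thesis
      using assms(3) by simp
  qed
next
  case (all_elim G x)
  then show ?thesis
    by (auto intro!: ax.all_elim formula_over_eliminate var)
next
  case (all_imp G H x)
  then show ?thesis
    using free_eliminate[of q j z G]
    by (auto intro!: ax.all_imp formula_over_eliminate var)
next
  case (all_ex G x)
  then show ?thesis
    by (auto intro!: ax.all_ex formula_over_eliminate var)
qed

lemma step_eliminate:
  assumes var: "\<And>x. [Var x] \<in> L"
    and nocc: "\<And>F. F \<in> ms_axioms M \<Longrightarrow> \<not> occurs_ary q j F"
    and sub: "set (rs_axioms (ms_rec M)) \<subseteq> ms_axioms M"
    and z: "z \<notin> rs_vars (ms_rec M)"
    and "step M L \<Gamma> F"
  shows "step M L (eliminate q j z ` \<Gamma>) (eliminate q j z F)"
  using assms(5)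
proof cases
  case axm
  then show ?thesis
    by (intro step.axm ax_eliminate var nocc)
next
  case (mp G)
  then show ?thesis
    by (intro step.mp[of "eliminate q j z G"]) force+
next
  case (subst G l x)
  then show ?thesis
    by (auto simp: eliminate_SbF intro!: step.subst CF_eliminate)
next
  case (gen G x)
  then show ?thesis
    by (auto intro!: step.gen)
next
  case (induction p xs G)
  have G: "formula M L (eliminate q j z G)"
    using induction by (intro formula_over_eliminate var)
  show ?thesis
  proof (cases "p = q \<and> length xs = j")
    case True
    then have "eliminate q j z F = Imp (contradiction z) (eliminate q j z G)"
      using induction by simp
    then show ?thesis
      using G by (auto intro!: step.axm ax_contradiction_Imp var)
  next
    case False
    then have F: "eliminate q j z F = Imp (Pred p (map (\<lambda>x. [Var x]) xs)) (eliminate q j z G)"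
      using induction by auto
    \<comment> \<open>The rule is applied again with the eliminated \<open>G\<close>. Its premises
      are the images of the old ones, because basis R-axioms are basis axioms of \<open>M\<close>
      and contain no \<open>j\<close>-ary \<open>q\<close>.\<close>
    have "replace_ary p (length xs) (\<lambda>ls. SbFs (eliminate q j z G) ls xs) B \<in> eliminate q j z ` \<Gamma>"
      if "B \<in> set (rs_axioms (ms_rec M))" "occurs_ary p (length xs) (R_conclusion B)" for B
    proof -
      have "\<not> occurs_ary q j B"
        using that sub nocc by auto
      then have "eliminate q j z (replace_ary p (length xs) (\<lambda>ls. SbFs G ls xs) B)
          = replace_ary p (length xs) (\<lambda>ls. SbFs (eliminate q j z G) ls xs) B"
        by (simp add: eliminate_replace_ary eliminate_SbFs)
      then show ?thesis
        using induction that by (metis imageI)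
    qed
    \<comment> \<open>The only variable that elimination can introduce is \<open>z\<close>, which
      was chosen outside the basis R-axioms.\<close>
    moreover have "fvars (eliminate q j z G) \<inter> rs_vars (ms_rec M) = {}"
      using fvars_eliminate[of q j z G] induction z by blast
    ultimately show ?thesis
      unfolding F using induction G by (intro step.induction) auto
  qed
qed

theorem mainTheorem2:
  fixes M :: "('c, 'p) math_system" and L :: "'c lst set"
    and q :: 'p and j :: nat and z :: vname and Fs :: "('c, 'p) fmla list"
  assumes "mathematical_system M L"
    and "q \<in> ms_preds M"
    and "\<forall>F\<in>ms_axioms M. \<not> occurs_ary q j F"
    and "z \<notin> rs_vars (ms_rec M)"
    and "is_proof M L Fs"
  shows "is_proof M L (map (eliminate q j z) Fs) \<and>
    (\<forall>F\<in>set (map (eliminate q j z) Fs). \<not> occurs_ary q j F)"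
proof
  \<comment> \<open>Elimination maps the formulas before position \<open>k\<close> onto those before
    position \<open>k\<close> in the new list, so each line can be treated separately.\<close>
  have "step M L (eliminate q j z ` set (take k Fs)) (eliminate q j z (Fs ! k))"
    if "k < length Fs" for k
    using assms that
    by (intro step_eliminate) (auto simp: mathematical_system_def is_proof_def)
  then show "is_proof M L (map (eliminate q j z) Fs)"
    by (simp add: is_proof_def take_map)
  show "\<forall>F\<in>set (map (eliminate q j z) Fs). \<not> occurs_ary q j F"
    by (simp add: not_occurs_ary_eliminate)
qed

end
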